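(* Let $T=\{(z,0): z\in\mathbb{D}\}\cup\{(0,z): z\in\mathbb{D}\}\subset\mathbb{C}^2$, where $\mathbb{D}$ is the open unit disc, and let $\Delta=\{\lambda\in\mathbb{C}^2 : |\lambda_1|+|\lambda_2|<1\}$. The pair $(\Delta,T)$ does not have the linear norm preserving extension property.
   Context: A function $f:V\to\mathbb{C}$ on an analytic set $V$ in a domain of holomorphy $\Omega\subseteq\mathbb{C}^n$ is holomorphic on $V$ if each $\lambda\in V$ has an open neighborhood $U$ in $\mathbb{C}^n$ and a holomorphic function $F$ on $U$ with $F=f$ on $V\cap U$. $\mathrm{Hol}^\infty(V)$ and $\mathrm{Hol}^\infty(\Omega)$ denote the bounded holomorphic functions on $V$ and on $\Omega$, with supremum norms. A Cartan pair is a pair $(\Omega,V)$ with $\Omega$ a domain of holomorphy and $V$ an analytic set in $\Omega$ (relatively closed in $\Omega$, and near each of its points the common zero set of finitely many holomorphic functions). A Cartan pair $(\Omega,V)$ has the linear norm preserving extension property if there is a linear isometry $E:\mathrm{Hol}^\infty(V)\to\mathrm{Hol}^\infty(\Omega)$ such that $(Ef)(\lambda)=f(\lambda)$ for every $f\in\mathrm{Hol}^\infty(V)$ and $\lambda\in V$. *)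

theory Defs
  imports "HOL-Analysis.Analysis"
begin

text \<open>Holomorphy in several variables: real Frechet differentiability with a complex-linear
  derivative. Only used for open \<open>U\<close>.\<close>

definition cn_holomorphic_on :: "(complex ^ 'n \<Rightarrow> complex) \<Rightarrow> (complex ^ 'n) set \<Rightarrow> bool"
    (infixl "cn'_holomorphic'_on" 50) where
  "F cn_holomorphic_on U \<longleftrightarrow>
     (\<forall>z\<in>U. \<exists>D. (F has_derivative D) (at z) \<and> (\<forall>c v. D (c *s v) = c * D v))"

text \<open>Domain of holomorphy in the standard sense: there is no single connected open set,
  not contained in \<open>\<Omega>\<close>, to which all functions holomorphic on \<open>\<Omega>\<close> continue from
  a common nonempty open part \<open>W\<close> of the overlap (which need not be connected).\<close>

definition domain_of_holomorphy :: "(complex ^ 'n) set \<Rightarrow> bool" where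
  "domain_of_holomorphy \<Omega> \<longleftrightarrow>
     open \<Omega> \<and> connected \<Omega> \<and> \<Omega> \<noteq> {} \<and>
     \<not> (\<exists>W U. open W \<and> W \<noteq> {} \<and> W \<subseteq> U \<inter> \<Omega> \<and>
              open U \<and> connected U \<and> \<not> U \<subseteq> \<Omega> \<and>
              (\<forall>F. F cn_holomorphic_on \<Omega> \<longrightarrow>
                   (\<exists>G. G cn_holomorphic_on U \<and> (\<forall>z\<in>W. G z = F z))))"

definition analytic_set_in :: "(complex ^ 'n) set \<Rightarrow> (complex ^ 'n) set \<Rightarrow> bool" where
  "analytic_set_in \<Omega> V \<longleftrightarrow>
     closedin (top_of_set \<Omega>) V \<and>
     (\<forall>p\<in>V. \<exists>U Fs. open U \<and> p \<in> U \<and> U \<subseteq> \<Omega> \<and> finite Fs \<and>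
        (\<forall>F\<in>Fs. F cn_holomorphic_on U) \<and> V \<inter> U = {z\<in>U. \<forall>F\<in>Fs. F z = 0})"

definition cartan_pair :: "(complex ^ 'n) set \<Rightarrow> (complex ^ 'n) set \<Rightarrow> bool" where
  "cartan_pair \<Omega> V \<longleftrightarrow> domain_of_holomorphy \<Omega> \<and> analytic_set_in \<Omega> V"

definition holomorphic_on_analytic_set ::
    "(complex ^ 'n \<Rightarrow> complex) \<Rightarrow> (complex ^ 'n) set \<Rightarrow> bool" where
  "holomorphic_on_analytic_set f V \<longleftrightarrow>
     (\<forall>p\<in>V. \<exists>U F. open U \<and> p \<in> U \<and> F cn_holomorphic_on U \<and> (\<forall>z\<in>V \<inter> U. F z = f z))"

text \<open>A function on a set \<open>S\<close> is represented by its extension by zero to the whole space, so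
  that equality of representatives is equality on \<open>S\<close> and the vector space operations
  are the pointwise ones. No condition at points outside \<open>S\<close> is imposed on the function represented.\<close>

definition Hol_inf_set :: "(complex ^ 'n) set \<Rightarrow> (complex ^ 'n \<Rightarrow> complex) set" where
  "Hol_inf_set V =
     {f. holomorphic_on_analytic_set f V \<and> bounded (f ` V) \<and> (\<forall>z. z \<notin> V \<longrightarrow> f z = 0)}"

definition Hol_inf_dom :: "(complex ^ 'n) set \<Rightarrow> (complex ^ 'n \<Rightarrow> complex) set" where
  "Hol_inf_dom \<Omega> =
     {f. f cn_holomorphic_on \<Omega> \<and> bounded (f ` \<Omega>) \<and> (\<forall>z. z \<notin> \<Omega> \<longrightarrow> f z = 0)}"

text \<open>Inserting \<open>0\<close> matters only for \<open>S = {}\<close>, where it gives the norm \<open>0\<close>.\<close>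

definition sup_norm_on :: "(complex ^ 'n) set \<Rightarrow> (complex ^ 'n \<Rightarrow> complex) \<Rightarrow> real" where
  "sup_norm_on S f = Sup (insert 0 ((\<lambda>z. norm (f z)) ` S))"

definition linear_norm_preserving_extension_property ::
    "(complex ^ 'n) set \<Rightarrow> (complex ^ 'n) set \<Rightarrow> bool" where
  "linear_norm_preserving_extension_property \<Omega> V \<longleftrightarrow>
     (\<exists>E. (\<forall>f\<in>Hol_inf_set V. E f \<in> Hol_inf_dom \<Omega>) \<and>
          (\<forall>f\<in>Hol_inf_set V. \<forall>g\<in>Hol_inf_set V. E (\<lambda>z. f z + g z) = (\<lambda>z. E f z + E g z)) \<and>
          (\<forall>c. \<forall>f\<in>Hol_inf_set V. E (\<lambda>z. c * f z) = (\<lambda>z. c * E f z)) \<and>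
          (\<forall>f\<in>Hol_inf_set V. sup_norm_on \<Omega> (E f) = sup_norm_on V f) \<and>
          (\<forall>f\<in>Hol_inf_set V. \<forall>p\<in>V. E f p = f p))"

definition T_set :: "(complex ^ 2) set" where
  "T_set = {vector [z, 0] |z. z \<in> ball 0 1} \<union> {vector [0, z] |z. z \<in> ball 0 1}"

definition Delta_set :: "(complex ^ 2) set" where
  "Delta_set = {p. norm (p $ 1) + norm (p $ 2) < 1}"

end

theory Submission
  imports Defs "HOL-Complex_Analysis.Conformal_Mappings"
begin

text \<open>
  Let \<open>m(w) = (2w + 1) / (w + 2)\<close>, a disc automorphism, and for \<open>\<alpha>, \<beta> \<in> {1, -1}\<close> let \<open>f\<^bsub>\<alpha>\<beta>\<^esub>\<close> be
  \<open>m(\<alpha>z)\<close> on the first disc of \<open>T\<close> and \<open>m(\<beta>z)\<close> on the second. Let \<open>F\<close> be an extension of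
  \<open>f\<^bsub>\<alpha>\<beta>\<^esub>\<close> of norm at most 1. Along \<open>z \<mapsto> (z/2, \<alpha>\<beta>z/2)\<close> it has value \<open>m(0)\<close> and derivative
  \<open>\<alpha>m'(0)\<close> at the origin, so equality in the Schwarz--Pick lemma forces
  \<open>F(z/2, \<alpha>\<beta>z/2) = m(\<alpha>z)\<close>. Now \<open>f\<^bsub>1,1\<^esub> + f\<^bsub>-1,-1\<^esub> = f\<^bsub>1,-1\<^esub> + f\<^bsub>-1,1\<^esub>\<close> on \<open>T\<close>, so under a linear
  isometric extension the two sides extend to the same function \<open>G\<close>, which therefore equals
  \<open>h(z) = m(z) + m(-z)\<close> at \<open>(z, 0)\<close>, \<open>(0, z)\<close> and \<open>(z/2, \<plusminus>z/2)\<close>. The parallelogram law for the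
  second-order part of \<open>G\<close> at the origin would then give \<open>h''(0) = 0\<close>, which is false.
\<close>

subsection \<open>Functions of several variables on complex lines\<close>

text \<open>Chain rule: complex linearity of \<open>D\<close> turns the real derivative
  \<open>h \<mapsto> D (h *s b)\<close> into multiplication by \<open>D b\<close>.\<close>

lemma cn_holomorphic_on_slice_derivative:
  fixes F :: "complex ^ 'n \<Rightarrow> complex"
  assumes "(F has_derivative D) (at (a + z *s b))" "\<And>c v. D (c *s v) = c * D v"
  shows "((\<lambda>z. F (a + z *s b)) has_field_derivative D b) (at z)"
proof -
  have "bounded_linear (\<lambda>z::complex. z *s b)"
    by (rule linear_conv_bounded_linear[THEN iffD1], rule linearI)
      (auto simp: vec_eq_iff algebra_simps)
  then have "((\<lambda>z. a + z *s b) has_derivative (\<lambda>h. h *s b)) (at z)"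
    by (auto intro!: derivative_eq_intros bounded_linear_imp_has_derivative)
  from has_derivative_compose[OF this assms(1)] show ?thesis
    by (simp add: has_field_derivative_def assms(2) mult_commute_abs)
qed

lemma cn_holomorphic_on_slice:
  fixes F :: "complex ^ 'n \<Rightarrow> complex"
  assumes "F cn_holomorphic_on U" "\<And>z. z \<in> S \<Longrightarrow> a + z *s b \<in> U"
  shows "(\<lambda>z. F (a + z *s b)) holomorphic_on S"
  unfolding holomorphic_on_def field_differentiable_def
proof
  fix z assume "z \<in> S"
  then obtain D where "(F has_derivative D) (at (a + z *s b))" "\<And>c v. D (c *s v) = c * D v"
    using assms unfolding cn_holomorphic_on_def by blast
  then show "\<exists>f'. ((\<lambda>z. F (a + z *s b)) has_field_derivative f') (at z within S)"
    using cn_holomorphic_on_slice_derivative has_field_derivative_at_within by blast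
qed

text \<open>The interior of the zero set is open and relatively closed in the connected set
  \<open>U\<close>. Closedness reduces to one variable: in a ball around a limit point
  \<open>q\<close>, every point lies on a complex line through a point \<open>r\<close> near which
  \<open>F\<close> vanishes.\<close>

lemma cn_holomorphic_on_identity:
  fixes F :: "complex ^ 'n \<Rightarrow> complex"
  assumes F: "F cn_holomorphic_on U" and U: "open U" "connected U"
    and W: "open W" "W \<noteq> {}" "W \<subseteq> U" "\<And>z. z \<in> W \<Longrightarrow> F z = 0"
    and "z \<in> U"
  shows "F z = 0"
proof -
  define A where "A = interior {z \<in> U. F z = 0}"
  have AU: "A \<subseteq> {z \<in> U. F z = 0}" and "open A"
    unfolding A_def by (auto simp: interior_subset)
  have "W \<subseteq> A" unfolding A_def using W by (intro interior_maximal) auto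
  have "q \<in> A" if "q \<in> U" "q \<in> closure A" for q
  proof -
    obtain e where e: "e > 0" "ball q e \<subseteq> U" using U \<open>q \<in> U\<close> open_contains_ball by blast
    obtain r where r: "r \<in> A" "r \<in> ball q e"
      using \<open>q \<in> closure A\<close> e(1) by (metis closure_approachable dist_commute mem_ball)
    have "F y = 0" if y: "y \<in> ball q e" for y
    proof -
      define L where "L = (\<lambda>\<zeta>::complex. r + \<zeta> *s (y - r))"
      have lin: "linear (\<lambda>\<zeta>::complex. \<zeta> *s (y - r))"
        by (rule linearI) (auto simp: vec_eq_iff algebra_simps)
      have cont: "continuous_on UNIV L"
        unfolding L_def using linear_continuous_on[of "\<lambda>\<zeta>::complex. \<zeta> *s (y - r)"] lin
        by (intro continuous_intros) (simp add: linear_conv_bounded_linear)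
      define S where "S = L -` ball q e"
      define S' where "S' = L -` (A \<inter> ball q e)"
      \<comment> \<open>Moving the ball by \<open>-r\<close> replaces the affine map
        \<open>L\<close> by a linear one, whose preimages of convex sets are convex. So
        \<open>S\<close> is connected, as one-variable continuation from \<open>L 0 = r\<close> to
        \<open>L 1 = y\<close> requires.\<close>
      have "convex ((\<lambda>x. -r + x) ` ball q e)" by (intro convex_translation convex_ball)
      then have "convex ((\<lambda>\<zeta>::complex. \<zeta> *s (y - r)) -` ((\<lambda>x. -r + x) ` ball q e))"
        using lin by (intro convex_linear_vimage)
      moreover have "(\<lambda>\<zeta>::complex. \<zeta> *s (y - r)) -` ((\<lambda>x. -r + x) ` ball q e) = S"
        unfolding S_def L_def by (auto simp: image_iff intro!: bexI[of _ "r + _ *s (y - r)"])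
      ultimately have "convex S" by simp
      moreover have "open S" "open S'"
        unfolding S_def S'_def using cont \<open>open A\<close> by (auto intro!: open_vimage simp: continuous_on_eq_continuous_at)
      moreover have "0 \<in> S'" "1 \<in> S" "S' \<subseteq> S"
        using r y by (auto simp: S_def S'_def L_def)
      moreover have "(\<lambda>\<zeta>. F (L \<zeta>)) holomorphic_on S"
        unfolding L_def using e by (intro cn_holomorphic_on_slice[OF F]) (auto simp: S_def L_def)
      moreover have "F (L \<zeta>) = 0" if "\<zeta> \<in> S'" for \<zeta>
        using that AU by (auto simp: S'_def)
      ultimately have "F (L 1) = 0"
        using analytic_continuation_open[of S' S "\<lambda>\<zeta>. F (L \<zeta>)" "\<lambda>_. 0" 1]
        by (auto simp: convex_connected)
      then show ?thesis by (simp add: L_def)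
    qed
    then have "ball q e \<subseteq> A" unfolding A_def using e by (intro interior_maximal) auto
    then show ?thesis using e by auto
  qed
  then have "A = U \<inter> closure A" using AU closure_subset by blast
  then have "closedin (top_of_set U) A" by (metis closed_closure closedin_closed_Int)
  moreover have "openin (top_of_set U) A"
    using \<open>open A\<close> AU by (intro open_openin_trans) (auto intro: U)
  ultimately have "A = {} \<or> A = U" using U connected_clopen by blast
  then show ?thesis using \<open>W \<subseteq> A\<close> W AU \<open>z \<in> U\<close> by blast
qed

section \<open>Closure properties of holomorphy in several variables\<close>

lemma cn_holomorphic_on_linear:
  fixes a b :: complex
  shows "(\<lambda>p::complex^2. a * p $ 1 + b * p $ 2 - c) cn_holomorphic_on U"
  unfolding cn_holomorphic_on_def
proof
  fix z :: "complex^2"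
  have "((\<lambda>p::complex^2. a * p $ 1 + b * p $ 2 - c) has_derivative (\<lambda>p. a * p $ 1 + b * p $ 2)) (at z)"
    by (auto intro!: derivative_eq_intros bounded_linear_imp_has_derivative bounded_linear_vec_nth)
  then show "\<exists>D. ((\<lambda>p::complex^2. a * p $ 1 + b * p $ 2 - c) has_derivative D) (at z) \<and>
               (\<forall>c v. D (c *s v) = c * D v)"
    by (intro exI conjI) (auto simp: algebra_simps)
qed

lemma cn_holomorphic_on_add:
  assumes "F cn_holomorphic_on U" "G cn_holomorphic_on U"
  shows "(\<lambda>p. F p + G p) cn_holomorphic_on U"
  unfolding cn_holomorphic_on_def
proof
  fix z assume "z \<in> U"
  then obtain D D' where "(F has_derivative D) (at z)" "\<And>c v. D (c *s v) = c * D v"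
     "(G has_derivative D') (at z)" "\<And>c v. D' (c *s v) = c * D' v"
    using assms unfolding cn_holomorphic_on_def by blast
  then show "\<exists>D. ((\<lambda>p. F p + G p) has_derivative D) (at z) \<and> (\<forall>c v. D (c *s v) = c * D v)"
    by (intro exI[of _ "\<lambda>h. D h + D' h"] conjI has_derivative_add) (auto simp: algebra_simps)
qed

lemma cn_holomorphic_on_mult:
  assumes "F cn_holomorphic_on U" "G cn_holomorphic_on U"
  shows "(\<lambda>p. F p * G p) cn_holomorphic_on U"
  unfolding cn_holomorphic_on_def
proof
  fix z assume "z \<in> U"
  then obtain D D' where "(F has_derivative D) (at z)" "\<And>c v. D (c *s v) = c * D v"
     "(G has_derivative D') (at z)" "\<And>c v. D' (c *s v) = c * D' v"
    using assms unfolding cn_holomorphic_on_def by blast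
  then show "\<exists>D. ((\<lambda>p. F p * G p) has_derivative D) (at z) \<and> (\<forall>c v. D (c *s v) = c * D v)"
    by (intro exI[of _ "\<lambda>h. F z * D' h + D h * G z"] conjI has_derivative_mult)
       (auto simp: algebra_simps)
qed

lemma cn_holomorphic_on_compose:
  assumes "F cn_holomorphic_on U" "g holomorphic_on S" "open S" "\<And>z. z \<in> U \<Longrightarrow> F z \<in> S"
  shows "(\<lambda>p. g (F p)) cn_holomorphic_on U"
  unfolding cn_holomorphic_on_def
proof
  fix z assume z: "z \<in> U"
  then obtain D where D: "(F has_derivative D) (at z)" "\<And>c v. D (c *s v) = c * D v"
    using assms unfolding cn_holomorphic_on_def by blast
  have "(g has_field_derivative deriv g (F z)) (at (F z))"
    using assms z holomorphic_derivI by blast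
  then have "(g has_derivative (*) (deriv g (F z))) (at (F z))"
    by (simp add: has_field_derivative_def)
  from has_derivative_compose[OF D(1) this]
  show "\<exists>D. ((\<lambda>p. g (F p)) has_derivative D) (at z) \<and> (\<forall>c v. D (c *s v) = c * D v)"
    by (intro exI conjI) (auto simp: D)
qed

subsection \<open>The Cartan pair\<close>

lemma open_Delta_set: "open Delta_set"
  unfolding Delta_set_def by (intro open_Collect_less continuous_intros)

lemma convex_Delta_set: "convex Delta_set"
proof (rule convexI)
  fix x y :: "complex^2" and u v :: real
  assume xy: "x \<in> Delta_set" "y \<in> Delta_set" and uv: "0 \<le> u" "0 \<le> v" "u + v = 1"
  have "norm ((u *\<^sub>R x + v *\<^sub>R y) $ i) \<le> u * norm (x $ i) + v * norm (y $ i)" for i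
    using uv norm_triangle_ineq[of "u *\<^sub>R (x $ i)" "v *\<^sub>R (y $ i)"] by simp
  from this[of 1] this[of 2]
  have "norm ((u *\<^sub>R x + v *\<^sub>R y) $ 1) + norm ((u *\<^sub>R x + v *\<^sub>R y) $ 2) \<le>
      u * (norm (x $ 1) + norm (x $ 2)) + v * (norm (y $ 1) + norm (y $ 2))"
    by (simp only: distrib_left)
  also have "\<dots> < 1"
    using xy uv by (intro convex_bound_lt) (auto simp: Delta_set_def)
  finally show "u *\<^sub>R x + v *\<^sub>R y \<in> Delta_set" by (simp add: Delta_set_def)
qed

text \<open>A point \<open>p\<close> outside the domain is separated from it by a complex linear function \<open>l\<close>. A
  continuation of \<open>1 / (l - l p)\<close> to \<open>U\<close> would satisfy \<open>(l - l p) * G = 1\<close> on all of \<open>U\<close> by the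
  identity theorem, in particular at \<open>p\<close>.\<close>

lemma domain_of_holomorphy_Delta_set: "domain_of_holomorphy Delta_set"
proof -
  have False
    if W: "open W" "W \<noteq> {}" "W \<subseteq> U \<inter> Delta_set" and U: "open U" "connected U" "\<not> U \<subseteq> Delta_set"
      and ext: "\<forall>F. F cn_holomorphic_on Delta_set \<longrightarrow> (\<exists>G. G cn_holomorphic_on U \<and> (\<forall>z\<in>W. G z = F z))"
    for W U
  proof -
    obtain p where p: "p \<in> U" "p \<notin> Delta_set" using U by blast
    \<comment> \<open>Unimodular factors turn the coordinates of \<open>p\<close> into their moduli.
      Thus \<open>a * z $ 1 + b * z $ 2\<close> has modulus below 1 on the domain but the value
      \<open>norm (p $ 1) + norm (p $ 2) \<ge> 1\<close> at \<open>p\<close>.\<close>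
    have rot: "\<exists>a. norm a = 1 \<and> a * w = of_real (norm w)" for w :: complex
    proof (cases "w = 0")
      case False
      then have "cnj w / of_real (norm w) * w = of_real (norm w)"
        using complex_norm_square[of w] by (simp add: field_simps power2_eq_square)
      with False show ?thesis
        by (intro exI[of _ "cnj w / of_real (norm w)"]) (simp add: norm_divide)
    qed (auto intro: exI[of _ 1])
    obtain a b where a: "norm a = 1" "a * p $ 1 = of_real (norm (p $ 1))"
      and b: "norm b = 1" "b * p $ 2 = of_real (norm (p $ 2))"
      using rot by metis
    define c where "c = a * p $ 1 + b * p $ 2"
    define l where "l = (\<lambda>z::complex^2. a * z $ 1 + b * z $ 2 - c)"
    have l: "l cn_holomorphic_on V" for V unfolding l_def by (rule cn_holomorphic_on_linear)
    have "c = of_real (norm (p $ 1) + norm (p $ 2))" by (simp add: c_def a b)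
    then have "norm c = norm (p $ 1) + norm (p $ 2)"
      by (metis abs_of_nonneg add_nonneg_nonneg norm_ge_zero norm_of_real)
    then have c: "norm c \<ge> 1" using p by (simp add: Delta_set_def)
    have nz: "l z \<noteq> 0" if "z \<in> Delta_set" for z
    proof
      assume "l z = 0"
      then have "norm c \<le> norm (a * z $ 1) + norm (b * z $ 2)"
        unfolding l_def using norm_triangle_ineq[of "a * z $ 1" "b * z $ 2"] by simp
      then show False using that c a b by (simp add: Delta_set_def norm_mult)
    qed
    have "(\<lambda>z. inverse (l z)) cn_holomorphic_on Delta_set"
      using nz by (intro cn_holomorphic_on_compose[OF l, where S="-{0}"] holomorphic_intros) auto
    then obtain G where G: "G cn_holomorphic_on U" "\<forall>z\<in>W. G z = inverse (l z)"
      using ext by blast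
    have hol: "(\<lambda>z. l z * G z - 1) cn_holomorphic_on U"
      by (rule cn_holomorphic_on_compose[where g="\<lambda>u. u - 1" and S=UNIV, OF cn_holomorphic_on_mult[OF l G(1)]])
        (auto intro!: holomorphic_intros)
    have "l p * G p - 1 = 0"
      by (rule cn_holomorphic_on_identity[OF hol U(1,2) W(1,2)]) (use W G nz p in auto)
    then show False by (simp add: l_def c_def)
  qed
  moreover have "0 \<in> Delta_set" by (simp add: Delta_set_def)
  ultimately show ?thesis
    unfolding domain_of_holomorphy_def
    using open_Delta_set convex_connected[OF convex_Delta_set] by blast
qed

text \<open>Replaces the parametrised cross by one global defining function, from which relative
  closedness and analyticity follow.\<close>

lemma T_set_eq: "T_set = {p \<in> Delta_set. p $ 1 * p $ 2 = 0}"
proof (intro equalityI subsetI)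
  fix p assume "p \<in> {p \<in> Delta_set. p $ 1 * p $ 2 = 0}"
  then have "p = vector [p $ 1, 0] \<and> p $ 1 \<in> ball 0 1 \<or> p = vector [0, p $ 2] \<and> p $ 2 \<in> ball 0 1"
    by (auto simp: Delta_set_def vec_eq_iff forall_2)
  then show "p \<in> T_set" unfolding T_set_def by blast
qed (auto simp: T_set_def Delta_set_def)

lemma cartan_pair_Delta_T: "cartan_pair Delta_set T_set"
proof -
  have hol: "(\<lambda>p::complex^2. p $ 1 * p $ 2) cn_holomorphic_on Delta_set"
    using cn_holomorphic_on_mult[OF cn_holomorphic_on_linear[of 1 0 0] cn_holomorphic_on_linear[of 0 1 0]]
    by simp
  have "closed {p::complex^2. p $ 1 * p $ 2 = 0}"
    by (intro closed_Collect_eq continuous_intros)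
  moreover have "T_set = Delta_set \<inter> {p. p $ 1 * p $ 2 = 0}" by (auto simp: T_set_eq)
  ultimately have "closedin (top_of_set Delta_set) T_set"
    by (metis closedin_closed_Int)
  moreover have "\<exists>U Fs. open U \<and> p \<in> U \<and> U \<subseteq> Delta_set \<and> finite Fs \<and>
        (\<forall>F\<in>Fs. F cn_holomorphic_on U) \<and> T_set \<inter> U = {z\<in>U. \<forall>F\<in>Fs. F z = 0}" if "p \<in> T_set" for p
    using that hol open_Delta_set
    by (intro exI[of _ Delta_set] exI[of _ "{\<lambda>p. p $ 1 * p $ 2}"]) (auto simp: T_set_eq)
  ultimately show ?thesis
    unfolding cartan_pair_def analytic_set_in_def using domain_of_holomorphy_Delta_set by blast
qed

subsection \<open>Schwarz and Schwarz--Pick\<close>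

text \<open>The Schwarz lemma after rescaling the source disc by \<open>r\<close> and the target
  disc by \<open>M\<close>.\<close>

lemma Schwarz_bound:
  assumes f: "f holomorphic_on ball 0 r" "f 0 = 0" and M: "\<And>z. norm z < r \<Longrightarrow> norm (f z) < M"
    and z: "norm z < r"
  shows "norm (f z) \<le> M * norm z / r"
proof -
  have r: "r > 0" using z norm_ge_zero[of z] by linarith
  have "M > 0" using M[of 0] f r by simp
  define g where "g = (\<lambda>w. f (of_real r * w) / of_real M)"
  have in_ball: "norm (of_real r * w) < r" if "norm w < 1" for w :: complex
    using that r by (simp add: norm_mult)
  have "(f \<circ> (\<lambda>w. of_real r * w)) holomorphic_on ball 0 1"
    by (rule holomorphic_on_compose_gen[OF _ f(1)]) (use in_ball in \<open>auto intro!: holomorphic_intros\<close>)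
  then have "g holomorphic_on ball 0 1"
    unfolding g_def o_def using \<open>M > 0\<close> by (intro holomorphic_intros) auto
  moreover have "norm (g w) < 1" if "norm w < 1" for w
    using M[OF in_ball[OF that]] \<open>M > 0\<close> by (simp add: g_def norm_divide)
  ultimately have "norm (g (z / of_real r)) \<le> norm (z / of_real r)"
    using f z r by (intro Schwarz_Lemma(1)) (auto simp: g_def norm_divide)
  then show ?thesis using \<open>M > 0\<close> r by (simp add: g_def norm_divide field_simps)
qed

text \<open>Evenness forces \<open>f'(0) = 0\<close>, so the quotient \<open>k = f / z\<close> also
  vanishes at 0 and the Schwarz bound applies a second time, to \<open>k\<close>.\<close>

lemma Schwarz_bound_even:
  assumes f: "f holomorphic_on ball 0 r" "f 0 = 0" and even: "\<And>z. f (- z) = f z"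
    and M: "\<And>z. norm z < r \<Longrightarrow> norm (f z) < M" and z: "norm z < r"
  shows "norm (f z) \<le> 2 * M * (norm z)\<^sup>2 / r\<^sup>2"
proof -
  have r: "r > 0" using z norm_ge_zero[of z] by linarith
  have "M > 0" using M[of 0] f r by simp
  obtain k where k: "k holomorphic_on ball 0 r" "\<And>z. norm z < r \<Longrightarrow> f z = z * k z" "deriv f 0 = k 0"
    using Schwarz3[OF f] by metis
  have d: "(f has_field_derivative k 0) (at 0)"
    using holomorphic_derivI[OF f(1) open_ball, of 0] r k(3) by simp
  have "((\<lambda>z. f (- z)) has_field_derivative - k 0) (at 0)"
    using DERIV_chain2[of f "k 0" uminus 0 "- 1" UNIV] d
    by (simp add: DERIV_minus[OF DERIV_ident])
  then have "k 0 = - k 0" using d DERIV_unique unfolding even by blast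
  then have k0: "k 0 = 0" by simp
  \<comment> \<open>The first application gives only the non-strict bound \<open>M / r\<close>; the
    factor 2 restores the strictness required by the second.\<close>
  have "norm (k w) < 2 * M / r" if w: "norm w < r" for w
  proof (cases "w = 0")
    case False
    have "norm w * norm (k w) \<le> norm w * (M / r)"
      using Schwarz_bound[OF f M w] k(2)[OF w] by (simp add: norm_mult mult_ac)
    then have "norm (k w) \<le> M / r" by (rule mult_left_le_imp_le) (use False in simp)
    also have "\<dots> < 2 * M / r" using \<open>M > 0\<close> r by (simp add: divide_strict_right_mono)
    finally show ?thesis .
  qed (use k0 \<open>M > 0\<close> r in simp)
  then have "norm (k z) \<le> 2 * M / r * norm z / r"
    by (rule Schwarz_bound[OF k(1) k0 _ z])
  then have "norm z * norm (k z) \<le> norm z * (2 * M / r * norm z / r)"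
    by (rule mult_left_mono) simp
  then show ?thesis using k(2)[OF z] by (simp add: norm_mult power2_eq_square mult_ac)
qed

definition mob :: "complex \<Rightarrow> complex" where "mob w = (2 * w + 1) / (w + 2)"

text \<open>The difference of the squared norms is
  \<open>3 * (1 - (norm w)\<^sup>2)\<close>.\<close>

lemma norm_double_add_one_less:
  assumes "norm (w::complex) < 1"
  shows "norm (2 * w + 1) < norm (w + 2)"
proof (rule power2_less_imp_less)
  have "(norm w)\<^sup>2 < 1" using assms by (simp add: power_less_one_iff abs_square_less_1)
  then show "(norm (2 * w + 1))\<^sup>2 < (norm (w + 2))\<^sup>2"
    unfolding cmod_power2 by (simp add: power2_eq_square algebra_simps)
qed simp

lemma add_2_neq_0: "norm (w::complex) < 1 \<Longrightarrow> w + 2 \<noteq> 0"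
  using norm_double_add_one_less[of w] by auto

lemma norm_mob: "norm w < 1 \<Longrightarrow> norm (mob w) < 1"
  using norm_double_add_one_less[of w] add_2_neq_0[of w] by (simp add: mob_def norm_divide)

lemma mob_holomorphic: "mob holomorphic_on ball 0 1"
  unfolding mob_def using add_2_neq_0 by (intro holomorphic_intros) auto

lemma mob_slice_derivative: "((\<lambda>z. mob (\<alpha> * z)) has_field_derivative 3 / 4 * \<alpha>) (at 0)"
  unfolding mob_def by (rule derivative_eq_intros refl | simp add: field_simps)+

lemma extremal_slice:
  fixes F :: "complex ^ 2 \<Rightarrow> complex"
  assumes F: "F cn_holomorphic_on Delta_set" and bd: "\<And>p. p \<in> Delta_set \<Longrightarrow> norm (F p) \<le> 1"
    and \<alpha>: "norm \<alpha> = 1" and \<omega>: "norm \<omega> = 1" "\<beta> * \<omega> = \<alpha>"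
    and ax1: "\<And>z. norm z < 1 \<Longrightarrow> F (vector [z, 0]) = mob (\<alpha> * z)"
    and ax2: "\<And>z. norm z < 1 \<Longrightarrow> F (vector [0, z]) = mob (\<beta> * z)"
    and z: "norm z < 1"
  shows "F (vector [z / 2, \<omega> * z / 2]) = mob (\<alpha> * z)"
proof -
  have "0 \<in> Delta_set" by (simp add: Delta_set_def)
  then obtain D where D: "(F has_derivative D) (at 0)" "\<And>c v. D (c *s v) = c * D v"
    using F unfolding cn_holomorphic_on_def by blast
  have der: "((\<lambda>z. F (z *s b)) has_field_derivative D b) (at 0)" for b
    using cn_holomorphic_on_slice_derivative[of F D 0 0 b] D by simp
  \<comment> \<open>The prescribed values on an axis determine the derivative of \<open>F\<close> at
    0 in that direction; by linearity the two axes determine \<open>D\<close> in the direction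
    \<open>b\<close>.\<close>
  have axis: "D b = 3 / 4 * \<gamma>" if "\<And>z. norm z < 1 \<Longrightarrow> F (z *s b) = mob (\<gamma> * z)" for b \<gamma>
  proof -
    have "((\<lambda>z. mob (\<gamma> * z)) has_field_derivative D b) (at 0)"
      by (rule has_field_derivative_transform_within_open[OF der open_ball[of 0 1]]) (auto simp: that)
    then show ?thesis using mob_slice_derivative DERIV_unique by blast
  qed
  have e1: "z *s vector [1, 0] = (vector [z, 0] :: complex^2)"
    and e2: "z *s vector [0, 1] = (vector [0, z] :: complex^2)" for z
    by (auto simp: vec_eq_iff forall_2)
  have D1: "D (vector [1, 0]) = 3 / 4 * \<alpha>" by (rule axis, unfold e1) (rule ax1)
  have D2: "D (vector [0, 1]) = 3 / 4 * \<beta>" by (rule axis, unfold e2) (rule ax2)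
  define b :: "complex^2" where "b = vector [1 / 2, \<omega> / 2]"
  have "b = (1/2) *s vector [1, 0] + (\<omega> / 2) *s vector [0, 1]"
    by (auto simp: vec_eq_iff forall_2 b_def)
  then have "D b = 1 / 2 * D (vector [1, 0]) + \<omega> / 2 * D (vector [0, 1])"
    using linear_add[OF has_derivative_linear[OF D(1)]] by (simp only: D(2))
  then have Db: "D b = 3 / 4 * \<alpha>" by (simp add: D1 D2 \<omega>(2)[symmetric])
  define g where "g = (\<lambda>z. F (z *s b))"
  have g': "(g has_field_derivative 3 / 4 * \<alpha>) (at 0)" using der[of b] Db by (simp add: g_def)
  have in_Delta: "z *s b \<in> Delta_set" if "norm z < 1" for z
    using that \<omega> by (simp add: Delta_set_def b_def norm_mult norm_divide)
  have ghol: "g holomorphic_on ball 0 1"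
    using cn_holomorphic_on_slice[OF F, of "ball 0 1" 0 b] in_Delta by (simp add: g_def)
  \<comment> \<open>The hypothesis bounds \<open>g\<close> only by \<le> 1. Nonconstancy, from the
    nonzero derivative at 0, and the open mapping theorem make the bound strict.\<close>
  have "\<not> g constant_on ball 0 1"
  proof
    assume "g constant_on ball 0 1"
    then obtain c where c: "\<And>x. x \<in> ball 0 1 \<Longrightarrow> g x = c" unfolding constant_on_def by blast
    have "((\<lambda>_. c) has_field_derivative 3 / 4 * \<alpha>) (at 0)"
      by (rule has_field_derivative_transform_within_open[OF g' open_ball[of 0 1]]) (auto simp: c)
    then have "3 / 4 * \<alpha> = 0" using DERIV_const DERIV_unique by blast
    then show False using \<alpha> by auto
  qed
  then have "open (g ` ball 0 1)"
    by (intro open_mapping_thm[OF ghol]) auto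
  moreover have "g ` ball 0 1 \<subseteq> cball 0 1" using bd in_Delta by (auto simp: g_def)
  ultimately have "g ` ball 0 1 \<subseteq> ball 0 1"
    using interior_maximal interior_cball by metis
  then have g1: "norm (g z) < 1" if "norm z < 1" for z using that by force
  have g2: "2 - g z \<noteq> 0" if "norm z < 1" for z using g1[OF that] by auto
  have "0 *s b = vector [0, 0]" by (auto simp: vec_eq_iff forall_2)
  then have "g 0 = 1 / 2" using ax1[of 0] by (simp add: g_def mob_def)
  \<comment> \<open>\<open>\<psi>\<close> is \<open>g\<close> followed by the inverse of
    \<open>mob\<close>. It fixes 0 and has derivative
    \<open>4/3 * (3/4 * \<alpha>) = \<alpha>\<close> there, of modulus 1, so it is a
    rotation.\<close>
  define \<psi> where "\<psi> = (\<lambda>z. (2 * g z - 1) / (2 - g z))"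
  have "\<psi> holomorphic_on ball 0 1"
    unfolding \<psi>_def using ghol g2 by (intro holomorphic_intros) auto
  moreover have "\<psi> 0 = 0" by (simp add: \<psi>_def \<open>g 0 = 1 / 2\<close>)
  moreover have "norm (\<psi> z) < 1" if "norm z < 1" for z
  proof -
    have "norm (2 * g z - 1) < norm (2 - g z)"
      using norm_double_add_one_less[of "- g z"] g1[OF that] norm_minus_commute[of 1 "2 * g z"] by simp
    then show ?thesis using g2[OF that] by (simp add: \<psi>_def norm_divide)
  qed
  moreover have \<psi>': "(\<psi> has_field_derivative \<alpha>) (at 0)"
    unfolding \<psi>_def
    by (rule derivative_eq_intros g' refl | simp add: \<open>g 0 = 1 / 2\<close> field_simps)+
  then have "norm (deriv \<psi> 0) = 1" using \<alpha> by (simp add: DERIV_imp_deriv)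
  ultimately obtain \<gamma> where \<gamma>: "\<And>z. norm z < 1 \<Longrightarrow> \<psi> z = \<gamma> * z"
    using Schwarz_Lemma(3)[of \<psi> 0] by force
  have "((*) \<gamma> has_field_derivative \<alpha>) (at 0)"
    by (rule has_field_derivative_transform_within_open[OF \<psi>' open_ball[of 0 1]]) (auto simp: \<gamma>)
  moreover have "((*) \<gamma> has_field_derivative \<gamma>) (at 0)"
    by (rule derivative_eq_intros refl | simp)+
  ultimately have "\<gamma> = \<alpha>" by (metis DERIV_unique)
  then have "2 * g z - 1 = \<alpha> * z * (2 - g z)"
    using \<gamma>[OF z] g2[OF z] by (simp add: \<psi>_def divide_eq_eq)
  then have "g z * (\<alpha> * z + 2) = 2 * (\<alpha> * z) + 1" by (simp add: algebra_simps)
  moreover have "\<alpha> * z + 2 \<noteq> 0" using z \<alpha> by (intro add_2_neq_0) (simp add: norm_mult)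
  ultimately have "g z = mob (\<alpha> * z)" by (simp add: mob_def eq_divide_eq)
  moreover have "z *s b = vector [z / 2, \<omega> * z / 2]"
    by (auto simp: vec_eq_iff forall_2 b_def)
  ultimately show ?thesis by (simp add: g_def)
qed

subsection \<open>The second-order obstruction\<close>

text \<open>\<open>H\<close> vanishes on both axes, so applying the Schwarz lemma first in \<open>x\<close> and then, to the even
  part, in \<open>w\<close> shows that \<open>H x x + H x (- x)\<close> is of third order; numerically it is too large for
  that at \<open>x = 1/200\<close>.\<close>

lemma mob_sum_not_on_axes_and_diagonals:
  fixes G :: "complex ^ 2 \<Rightarrow> complex"
  assumes G: "G cn_holomorphic_on Delta_set" and bd: "\<And>p. p \<in> Delta_set \<Longrightarrow> norm (G p) \<le> 2"
    and h: "h = (\<lambda>z. mob z + mob (- z))"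
    and ax1: "\<And>z. norm z < 1 \<Longrightarrow> G (vector [z, 0]) = h z"
    and ax2: "\<And>z. norm z < 1 \<Longrightarrow> G (vector [0, z]) = h z"
    and di1: "\<And>z. norm z < 1 \<Longrightarrow> G (vector [z / 2, z / 2]) = h z"
    and di2: "\<And>z. norm z < 1 \<Longrightarrow> G (vector [z / 2, - z / 2]) = h z"
  shows False
proof -
  \<comment> \<open>The mixed difference \<open>H\<close> removes the terms in \<open>x\<close>
    alone and in \<open>w\<close> alone; symmetrising in \<open>w\<close> gives \<open>S\<close>, of
    order one in \<open>x\<close> and two in \<open>w\<close>.\<close>
  define H where "H = (\<lambda>x w. G (vector [x, w]) - G (vector [x, 0]) - G (vector [0, w]) + G (vector [0, 0]))"
  define S where "S = (\<lambda>x w. H x w + H x (- w))"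
  have Delta: "vector [x, w] \<in> Delta_set" if "norm x < 1 / 2" "norm w < 1 / 2" for x w :: complex
    using that by (simp add: Delta_set_def)
  have slice: "(\<lambda>z. G (vector [a + z * c, b + z * d])) holomorphic_on ball 0 (1 / 2)"
    if "\<And>z. norm z < 1 / 2 \<Longrightarrow> vector [a + z * c, b + z * d] \<in> Delta_set" for a b c d
  proof -
    have "vector [a, b] + z *s vector [c, d] = (vector [a + z * c, b + z * d] :: complex^2)" for z
      by (auto simp: vec_eq_iff forall_2)
    then show ?thesis
      using cn_holomorphic_on_slice[OF G, of "ball 0 (1/2)" "vector [a, b]" "vector [c, d]"] that by simp
  qed
  have hol1: "(\<lambda>x. G (vector [x, w])) holomorphic_on ball 0 (1 / 2)" if "norm w < 1 / 2" for w
    using slice[of 0 1 w 0] Delta that by simp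
  have hol2: "(\<lambda>w. G (vector [x, w])) holomorphic_on ball 0 (1 / 2)" if "norm x < 1 / 2" for x
    using slice[of x 0 0 1] Delta that by simp
  have hol3: "(\<lambda>w. G (vector [x, - w])) holomorphic_on ball 0 (1 / 2)" if "norm x < 1 / 2" for x
    using slice[of x 0 0 "-1"] Delta that by simp
  \<comment> \<open>Four values of modulus at most 2 give 8; 9 makes the bound strict, and
    \<open>9 / (1/2) = 18\<close> is the next constant.\<close>
  have H9: "norm (H x w) < 9" if "norm x < 1 / 2" "norm w < 1 / 2" for x w
  proof -
    have "norm (H x w) \<le> norm (G (vector [x, w])) + norm (G (vector [x, 0])) + norm (G (vector [0, w])) + norm (G (vector [0, 0]))"
      unfolding H_def by (intro norm_triangle_le norm_triangle_le_diff add_mono order_refl)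
    also have "\<dots> \<le> 2 + 2 + 2 + 2" using that by (intro add_mono bd Delta) auto
    finally show ?thesis by simp
  qed
  have H18: "norm (H x w) \<le> 18 * norm x" if x: "norm x < 1 / 2" and w: "norm w < 1 / 2" for x w
  proof -
    have "(\<lambda>x. H x w) holomorphic_on ball 0 (1 / 2)"
      unfolding H_def using w by (intro holomorphic_intros hol1) auto
    from Schwarz_bound[OF this _ _ x, of 9] H9 w show ?thesis by (simp add: H_def)
  qed
  \<comment> \<open>Here 37 exceeds \<open>18 + 18\<close>; strictness needs
    \<open>x \<noteq> 0\<close>.\<close>
  have S: "norm (S x w) \<le> 2 * (37 * norm x) * (norm w)\<^sup>2 / (1 / 2)\<^sup>2"
    if x: "norm x < 1 / 2" "x \<noteq> 0" and w: "norm w < 1 / 2" for x w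
  proof (rule Schwarz_bound_even[OF _ _ _ _ w])
    show "S x holomorphic_on ball 0 (1 / 2)"
      unfolding S_def H_def using x by (intro holomorphic_intros hol2 hol3) auto
    show "S x 0 = 0" by (simp add: S_def H_def)
    show "S x (- z) = S x z" for z by (simp add: S_def add.commute)
    show "norm (S x z) < 37 * norm x" if "norm z < 1 / 2" for z
    proof -
      have "norm (S x z) \<le> norm (H x z) + norm (H x (- z))"
        unfolding S_def by (rule norm_triangle_ineq)
      also have "\<dots> \<le> 18 * norm x + 18 * norm x" using x that by (intro add_mono H18) auto
      also have "\<dots> < 37 * norm x" using x by simp
      finally show ?thesis .
    qed
  qed
  \<comment> \<open>At \<open>w = x\<close> the bound is \<open>296 * x^3\<close>, while
    \<open>S x x\<close> is close to \<open>-3 * x^2\<close>. For \<open>x = 1/200\<close> the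
    moduli are at most 37/1000000 and about 75/1000000.\<close>
  have "norm (S (1 / 200) (1 / 200)) \<le> 37 / 1000000"
    using S[of "1 / 200" "1 / 200"] by (simp add: power2_eq_square)
  moreover have "S (1 / 200) (1 / 200) = 2 * h (1 / 100) - 4 * h (1 / 200) + 2 * h 0"
    using di1[of "1 / 100"] di2[of "1 / 100"] ax1[of "1 / 200"] ax2[of "1 / 200"] ax2[of "- 1 / 200"] ax1[of 0]
    by (simp add: S_def H_def h)
  \<comment> \<open>These fractions come from
    \<open>h z = (4 - 4 * z^2) / (4 - z^2)\<close>.\<close>
  moreover have "2 * h (1 / 100) - 4 * h (1 / 200) + 2 * h 0 = of_real (2 * (39996 / 39999) - 4 * (159996 / 159999) + 2)"
    by (simp add: h mob_def)
  ultimately show False by (simp only: norm_of_real)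
qed

section \<open>The four sign choices and the contradiction\<close>

theorem theorem6p1:
  shows "cartan_pair Delta_set T_set \<and>
    \<not> linear_norm_preserving_extension_property Delta_set T_set"
proof (intro conjI notI cartan_pair_Delta_T)
  assume "linear_norm_preserving_extension_property Delta_set T_set"
  then obtain E where E: "\<And>f. f \<in> Hol_inf_set T_set \<Longrightarrow> E f \<in> Hol_inf_dom Delta_set"
    and add: "\<And>f g. f \<in> Hol_inf_set T_set \<Longrightarrow> g \<in> Hol_inf_set T_set \<Longrightarrow>
      E (\<lambda>z. f z + g z) = (\<lambda>z. E f z + E g z)"
    and norm_E: "\<And>f. f \<in> Hol_inf_set T_set \<Longrightarrow> sup_norm_on Delta_set (E f) = sup_norm_on T_set f"
    and ext: "\<And>f p. f \<in> Hol_inf_set T_set \<Longrightarrow> p \<in> T_set \<Longrightarrow> E f p = f p"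
    unfolding linear_norm_preserving_extension_property_def by blast
  \<comment> \<open>On \<open>T_set\<close> one coordinate vanishes, so a single formula covers both
    discs. The value 0 elsewhere is the one required of representatives in
    \<open>Hol_inf_set\<close>.\<close>
  define f where "f = (\<lambda>\<alpha> \<beta> p. if p \<in> T_set then mob (\<alpha> * p $ 1 + \<beta> * p $ 2) else 0)"
  define sgns :: "complex set" where "sgns = {1, -1}"
  have sgns: "norm \<alpha> = 1" if "\<alpha> \<in> sgns" for \<alpha> using that by (auto simp: sgns_def)
  have lin1: "norm (\<alpha> * p $ 1 + \<beta> * p $ 2) < 1" if "\<alpha> \<in> sgns" "\<beta> \<in> sgns" "p \<in> Delta_set" for \<alpha> \<beta> p
    using norm_triangle_ineq[of "\<alpha> * p $ 1" "\<beta> * p $ 2"] sgns that by (simp add: norm_mult Delta_set_def)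
  have f_le: "norm (f \<alpha> \<beta> p) \<le> 1" if "\<alpha> \<in> sgns" "\<beta> \<in> sgns" for \<alpha> \<beta> p
    using norm_mob[OF lin1[OF that]] by (auto simp: f_def T_set_eq intro: less_imp_le)
  have f_Hol: "f \<alpha> \<beta> \<in> Hol_inf_set T_set" if ab: "\<alpha> \<in> sgns" "\<beta> \<in> sgns" for \<alpha> \<beta>
  proof -
    have "(\<lambda>p. mob (\<alpha> * p $ 1 + \<beta> * p $ 2 - 0)) cn_holomorphic_on Delta_set"
      using lin1[OF ab]
      by (intro cn_holomorphic_on_compose[OF cn_holomorphic_on_linear mob_holomorphic]) auto
    then have "\<exists>U F. open U \<and> p \<in> U \<and> F cn_holomorphic_on U \<and> (\<forall>z\<in>T_set \<inter> U. F z = f \<alpha> \<beta> z)"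
      if "p \<in> T_set" for p
      using that open_Delta_set by (intro exI[of _ Delta_set] exI) (auto simp: T_set_eq f_def)
    moreover have "bounded (f \<alpha> \<beta> ` T_set)" using f_le[OF ab] by (auto intro!: boundedI)
    ultimately show ?thesis
      by (auto simp: Hol_inf_set_def holomorphic_on_analytic_set_def f_def)
  qed
  define F where "F = (\<lambda>\<alpha> \<beta>. E (f \<alpha> \<beta>))"
  have F_hol: "F \<alpha> \<beta> cn_holomorphic_on Delta_set" if "\<alpha> \<in> sgns" "\<beta> \<in> sgns" for \<alpha> \<beta>
    using E[OF f_Hol[OF that]] by (simp add: F_def Hol_inf_dom_def)
  have F_le: "norm (F \<alpha> \<beta> p) \<le> 1" if ab: "\<alpha> \<in> sgns" "\<beta> \<in> sgns" and p: "p \<in> Delta_set" for \<alpha> \<beta> p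
  proof -
    have "bounded (F \<alpha> \<beta> ` Delta_set)"
      using E[OF f_Hol[OF ab]] by (simp add: F_def Hol_inf_dom_def)
    then have "bdd_above ((\<lambda>z. norm (F \<alpha> \<beta> z)) ` Delta_set)"
      unfolding bounded_iff by (auto simp: bdd_above_def)
    then have "norm (F \<alpha> \<beta> p) \<le> sup_norm_on Delta_set (F \<alpha> \<beta>)"
      unfolding sup_norm_on_def using p by (intro cSup_upper) auto
    also have "\<dots> = sup_norm_on T_set (f \<alpha> \<beta>)" using norm_E[OF f_Hol[OF ab]] by (simp add: F_def)
    also have "\<dots> \<le> 1" unfolding sup_norm_on_def using f_le[OF ab] by (intro cSup_least) auto
    finally show ?thesis .
  qed
  have in_T: "vector [z, 0] \<in> T_set" "vector [0, z] \<in> T_set" if "norm z < 1" for z :: complex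
    using that by (auto simp: T_set_eq Delta_set_def)
  have F_ax: "F \<alpha> \<beta> (vector [z, 0]) = mob (\<alpha> * z)" "F \<alpha> \<beta> (vector [0, z]) = mob (\<beta> * z)"
    if "\<alpha> \<in> sgns" "\<beta> \<in> sgns" "norm z < 1" for \<alpha> \<beta> z
    using ext[OF f_Hol[OF that(1,2)]] in_T[OF that(3)] by (auto simp: F_def f_def)
  have F_diag: "F \<alpha> \<beta> (vector [z / 2, \<omega> * z / 2]) = mob (\<alpha> * z)"
    if "\<alpha> \<in> sgns" "\<beta> \<in> sgns" "\<omega> \<in> sgns" "\<beta> * \<omega> = \<alpha>" "norm z < 1" for \<alpha> \<beta> \<omega> z
    by (rule extremal_slice[OF F_hol[OF that(1,2)] F_le[OF that(1,2)] sgns[OF that(1)] sgns[OF that(3)] that(4)])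
       (use that F_ax in auto)
  have pm: "1 \<in> sgns" "- 1 \<in> sgns" by (auto simp: sgns_def)
  \<comment> \<open>On each disc either side contains \<open>mob\<close> once with each sign, so
    both sums are \<open>mob z + mob (- z)\<close>.\<close>
  have "f 1 1 p + f (-1) (-1) p = f 1 (-1) p + f (-1) 1 p" for p
    by (auto simp: f_def T_set_eq)
  then have "E (\<lambda>p. f 1 1 p + f (-1) (-1) p) = E (\<lambda>p. f 1 (-1) p + f (-1) 1 p)" by simp
  then have FF: "F 1 1 p + F (-1) (-1) p = F 1 (-1) p + F (-1) 1 p" for p
    unfolding F_def add[OF f_Hol[OF pm(1) pm(1)] f_Hol[OF pm(2) pm(2)]]
      add[OF f_Hol[OF pm(1) pm(2)] f_Hol[OF pm(2) pm(1)]] by (rule fun_cong)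
  show False
  proof (rule mob_sum_not_on_axes_and_diagonals[of "\<lambda>p. F 1 1 p + F (-1) (-1) p"])
    show "(\<lambda>p. F 1 1 p + F (-1) (-1) p) cn_holomorphic_on Delta_set"
      by (intro cn_holomorphic_on_add F_hol pm)
    show "norm (F 1 1 p + F (-1) (-1) p) \<le> 2" if "p \<in> Delta_set" for p
      using F_le[OF pm(1) pm(1) that] F_le[OF pm(2) pm(2) that] norm_triangle_ineq[of "F 1 1 p" "F (-1) (-1) p"]
      by linarith
    \<comment> \<open>Equal signs control only the diagonal \<open>\<omega> = 1\<close>. On the
      antidiagonal \<open>FF\<close> switches to the opposite-sign pair, for which
      \<open>F_diag\<close> applies with \<open>\<omega> = -1\<close>.\<close>
    show "F 1 1 (vector [z / 2, - z / 2]) + F (-1) (-1) (vector [z / 2, - z / 2]) = mob z + mob (- z)"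
      if "norm z < 1" for z
      using F_diag[of 1 "-1" "-1" z] F_diag[of "-1" 1 "-1" z] pm that by (simp add: FF)
  qed (use pm F_ax F_diag[of 1 1 1] F_diag[of "-1" "-1" 1] in auto)
qed

end
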